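(* A connected nontrivial triangle-free graph is perfectly well-ve-dominated if and only if it is complete bipartite.
   Context: All graphs are finite, simple and undirected. A nontrivial graph is one with at least two vertices. A vertex $v$ ve-dominates an edge $e$ if at least one endpoint of $e$ belongs to the closed neighborhood $N_G[v]$. A set $D\subseteq V(G)$ is a ve-dominating set if every edge of $G$ is ve-dominated by some vertex of $D$; it is minimal if no proper subset is ve-dominating. $G$ is well-ve-dominated if all its minimal ve-dominating sets have the same cardinality, and perfectly well-ve-dominated if every induced subgraph of $G$ is well-ve-dominated. *)

theory Defs
  imports "Graph_Theory.Graph_Theory"
begin

text \<open>
  Finite simple undirected graphs are the symmetric digraphs of the locale \<^locale>\<open>graph\<close>:
  every undirected edge is represented by its two opposite arcs. All notions below are invariant
  under reversal of an arc.
\<close>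

definition closed_neighborhood :: "('a,'b) pre_digraph \<Rightarrow> 'a \<Rightarrow> 'a set" where
  "closed_neighborhood G v = insert v {u \<in> verts G. v \<rightarrow>\<^bsub>G\<^esub> u}"

definition ve_dominates :: "('a,'b) pre_digraph \<Rightarrow> 'a \<Rightarrow> 'b \<Rightarrow> bool" where
  "ve_dominates G v e \<longleftrightarrow>
     tail G e \<in> closed_neighborhood G v \<or> head G e \<in> closed_neighborhood G v"

definition ve_dominating_set :: "('a,'b) pre_digraph \<Rightarrow> 'a set \<Rightarrow> bool" where
  "ve_dominating_set G D \<longleftrightarrow>
     D \<subseteq> verts G \<and> (\<forall>e \<in> arcs G. \<exists>v \<in> D. ve_dominates G v e)"

definition minimal_ve_dominating_set :: "('a,'b) pre_digraph \<Rightarrow> 'a set \<Rightarrow> bool" where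
  "minimal_ve_dominating_set G D \<longleftrightarrow>
     ve_dominating_set G D \<and> (\<forall>D'. D' \<subset> D \<longrightarrow> \<not> ve_dominating_set G D')"

definition well_ve_dominated :: "('a,'b) pre_digraph \<Rightarrow> bool" where
  "well_ve_dominated G \<longleftrightarrow>
     (\<forall>D D'. minimal_ve_dominating_set G D \<and> minimal_ve_dominating_set G D' \<longrightarrow> card D = card D')"

text \<open>
  The relation \<^const>\<open>induced_subgraph\<close> also admits the null graph, which is harmless here: its
  only ve-dominating set is empty.
\<close>

definition perfectly_well_ve_dominated :: "('a,'b) pre_digraph \<Rightarrow> bool" where
  "perfectly_well_ve_dominated G \<longleftrightarrow> (\<forall>H. induced_subgraph H G \<longrightarrow> well_ve_dominated H)"

definition triangle_free :: "('a,'b) pre_digraph \<Rightarrow> bool" where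
  "triangle_free G \<longleftrightarrow> \<not> (\<exists>H. subgraph H G \<and> complete_digraph 3 H)"

text \<open>Both sides of the bipartition are required to be nonempty.\<close>

definition complete_bipartite :: "('a,'b) pre_digraph \<Rightarrow> bool" where
  "complete_bipartite G \<longleftrightarrow> (\<exists>m n. 1 \<le> m \<and> 1 \<le> n \<and> complete_bipartite_digraph m n G)"

end

theory Submission
  imports Defs
begin

text \<open>
  In a complete bipartite graph with both sides nonempty, the neighbourhood of a vertex is the
  whole opposite side, and this side meets every edge. So each single vertex is a ve-dominating
  set. An induced subgraph is again complete bipartite or has no edges, hence all its minimal
  ve-dominating sets have one element, or all are empty
  (\<open>card_minimal_if_all_dominate\<close>).

  Conversely, an induced path $a\,b\,c\,d$ on four vertices has the minimal ve-dominating sets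
  $\{b\}$ and $\{a,d\}$, so a perfectly well-ve-dominated graph has no such path
  (\<open>not_perfectly_well_ve_dominated_if_P4\<close>). A connected graph without triangles and
  without induced paths on four vertices is complete bipartite
  (\<open>complete_bipartite_if_no_triangle_no_P4\<close>): for an edge $uv$, the neighbourhoods of
  $v$ and of $u$ are the two sides.
\<close>

section \<open>Ve-domination in terms of adjacency\<close>

lemma ve_dominating_set_iff_dominates:
  "ve_dominating_set G D \<longleftrightarrow> D \<subseteq> verts G \<and>
     (\<forall>x y. x \<rightarrow>\<^bsub>G\<^esub> y \<longrightarrow>
       (\<exists>v\<in>D. x \<in> closed_neighborhood G v \<or> y \<in> closed_neighborhood G v))"
  unfolding ve_dominating_set_def ve_dominates_def by (fastforce simp: arcs_ends_conv)

lemma dominates_induce_subgraph_iff: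
  "u \<rightarrow>\<^bsub>G \<restriction> S\<^esub> v \<longleftrightarrow> u \<rightarrow>\<^bsub>G\<^esub> v \<and> u \<in> S \<and> v \<in> S"
  by (auto simp: arcs_ends_conv)

lemma (in wf_digraph) closed_neighborhood_eq:
  "closed_neighborhood G v = insert v {u. v \<rightarrow> u}"
  by (auto simp: closed_neighborhood_def dest: adj_in_verts)

lemma ve_dominating_set_mono:
  assumes "ve_dominating_set G D" "D \<subseteq> E" "E \<subseteq> verts G"
  shows "ve_dominating_set G E"
  using assms unfolding ve_dominating_set_def by blast

text \<open>By monotonicity, minimality only has to be tested against deletion of one vertex.\<close>

lemma minimal_ve_dominating_setI:
  assumes "ve_dominating_set G D"
    and "\<And>v. v \<in> D \<Longrightarrow> \<not> ve_dominating_set G (D - {v})"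
  shows "minimal_ve_dominating_set G D"
  unfolding minimal_ve_dominating_set_def
proof (intro conjI allI impI notI)
  fix D' assume "D' \<subset> D" and D': "ve_dominating_set G D'"
  then obtain v where "v \<in> D" "D' \<subseteq> D - {v}" by blast
  moreover have "D - {v} \<subseteq> verts G" using assms(1) by (auto simp: ve_dominating_set_def)
  ultimately show False using assms(2) ve_dominating_set_mono[OF D'] by blast
qed (fact assms(1))

section \<open>Complete bipartite graphs\<close>

text \<open>
  A minimal set is empty if there is no edge to dominate; otherwise it is nonempty, and any one
  of its vertices already suffices.
\<close>

lemma card_minimal_if_all_dominate:
  assumes all: "\<And>v e. v \<in> verts G \<Longrightarrow> e \<in> arcs G \<Longrightarrow> ve_dominates G v e"
    and D: "minimal_ve_dominating_set G D"
  shows "card D = (if arcs G = {} then 0 else 1)"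
proof (cases "arcs G = {}")
  case True
  then have "ve_dominating_set G {}" by (simp add: ve_dominating_set_def)
  then have "D = {}" using D unfolding minimal_ve_dominating_set_def by blast
  then show ?thesis using True by simp
next
  case False
  with D obtain v where v: "v \<in> D" "v \<in> verts G"
    unfolding minimal_ve_dominating_set_def ve_dominating_set_def by blast
  then have "ve_dominating_set G {v}" using all by (simp add: ve_dominating_set_def)
  then have "D = {v}" using D v unfolding minimal_ve_dominating_set_def by blast
  then show ?thesis using False by simp
qed

lemma perfectly_well_ve_dominated_if_complete_bipartite:
  assumes "complete_bipartite G"
  shows "perfectly_well_ve_dominated G"
  unfolding perfectly_well_ve_dominated_def
proof (intro allI impI)
  fix H assume ind: "induced_subgraph H G"
  from assms obtain U V where UV: "verts G = U \<union> V"
    "arcs_ends G = U \<times> V \<union> V \<times> U"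
    unfolding complete_bipartite_def complete_bipartite_digraph_def by blast
  have H_eq: "H = G \<restriction> verts H"
    using ind by (auto simp: induced_subgraph_def induce_subgraph_def compatible_def)
  have sub: "verts H \<subseteq> verts G" using ind by auto
  interpret H: wf_digraph H using ind by (rule wf_digraphI_induced)
  have adj: "x \<rightarrow>\<^bsub>H\<^esub> y \<longleftrightarrow> x \<in> verts H \<and> y \<in> verts H \<and> (x, y) \<in> U \<times> V \<union> V \<times> U" for x y
    using dominates_induce_subgraph_iff[of x y G "verts H"] unfolding H_eq[symmetric] UV(2) by auto
  have "ve_dominates H v e" if "v \<in> verts H" "e \<in> arcs H" for v e
  proof -
    have "tail H e \<rightarrow>\<^bsub>H\<^esub> head H e" using that by (auto simp: arcs_ends_conv)
    moreover have "v \<in> U \<union> V" using that sub UV(1) by auto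
    ultimately show ?thesis
      using that(1) unfolding ve_dominates_def H.closed_neighborhood_eq by (auto simp: adj)
  qed
  from card_minimal_if_all_dominate[OF this] show "well_ve_dominated H"
    unfolding well_ve_dominated_def by metis
qed

section \<open>Induced paths on four vertices\<close>

text \<open>
  Every edge of the path has an end in $\{a,b,c\}$, the closed neighbourhood of $b$, so $b$
  dominates all three edges. An outer vertex misses exactly the edge at the far end, so the two
  outer vertices form a minimal set of the other size.
\<close>

lemma (in graph) not_perfectly_well_ve_dominated_if_P4:
  assumes path: "a \<rightarrow> b" "b \<rightarrow> c" "c \<rightarrow> d"
    and non: "\<not> a \<rightarrow> c" "\<not> b \<rightarrow> d" "\<not> a \<rightarrow> d" "a \<noteq> d"
  shows "\<not> perfectly_well_ve_dominated G"
proof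
  let ?H = "G \<restriction> {a, b, c, d}"
  assume "perfectly_well_ve_dominated G"
  moreover have "{a, b, c, d} \<subseteq> verts G" using path by (auto dest: adj_in_verts)
  ultimately have well: "well_ve_dominated ?H"
    unfolding perfectly_well_ve_dominated_def by blast
  interpret H: wf_digraph ?H by (rule wellformed_induce_subgraph)
  have irrefl: "\<not> x \<rightarrow> x" for x using adj_not_same by blast
  have sym: "x \<rightarrow> y \<longleftrightarrow> y \<rightarrow> x" for x y using graph_symmetric by blast
  have rev: "b \<rightarrow> a" "c \<rightarrow> b" "d \<rightarrow> c" "\<not> c \<rightarrow> a" "\<not> d \<rightarrow> b" "\<not> d \<rightarrow> a"
    using path non sym by blast+
  have neq: "a \<noteq> b" "b \<noteq> c" "c \<noteq> d" "a \<noteq> c" "b \<noteq> d"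
    using path irrefl non rev by metis+
  \<comment> \<open>Only d misses the edge ab, only a misses cd, and every vertex dominates bc.\<close>
  have dom: "ve_dominating_set ?H D \<longleftrightarrow> D \<subseteq> {a, b, c, d} \<and>
      (\<exists>v\<in>D. v \<noteq> d) \<and> (\<exists>v\<in>D. v \<noteq> a)" for D
  proof -
    have ends: "arcs_ends ?H = {(a,b), (b,a), (b,c), (c,b), (c,d), (d,c)}"
      by (auto simp: dominates_induce_subgraph_iff path non rev irrefl)
    have nbhd: "closed_neighborhood ?H a = {a, b}" "closed_neighborhood ?H b = {a, b, c}"
      "closed_neighborhood ?H c = {b, c, d}" "closed_neighborhood ?H d = {c, d}"
      by (auto simp: H.closed_neighborhood_eq ends neq neq[symmetric] non(4) non(4)[symmetric])
    have end_ab: "a \<in> closed_neighborhood ?H v \<or> b \<in> closed_neighborhood ?H v \<longleftrightarrow> v \<noteq> d"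
      and end_bc: "b \<in> closed_neighborhood ?H v \<or> c \<in> closed_neighborhood ?H v"
      and end_cd: "c \<in> closed_neighborhood ?H v \<or> d \<in> closed_neighborhood ?H v \<longleftrightarrow> v \<noteq> a"
      if "v \<in> {a, b, c, d}" for v
      using that neq non(4) by (auto simp: nbhd)
    have edges: "ve_dominating_set ?H D \<longleftrightarrow> D \<subseteq> {a, b, c, d} \<and>
        (\<exists>v\<in>D. a \<in> closed_neighborhood ?H v \<or> b \<in> closed_neighborhood ?H v) \<and>
        (\<exists>v\<in>D. b \<in> closed_neighborhood ?H v \<or> c \<in> closed_neighborhood ?H v) \<and>
        (\<exists>v\<in>D. c \<in> closed_neighborhood ?H v \<or> d \<in> closed_neighborhood ?H v)"
      unfolding ve_dominating_set_iff_dominates ends by simp blast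
    show ?thesis
    proof (cases "D \<subseteq> {a, b, c, d}")
      case True
      then have "v \<in> {a, b, c, d}" if "v \<in> D" for v using that by blast
      note on_D = end_ab[OF this] end_bc[OF this] end_cd[OF this]
      have "ve_dominating_set ?H D \<longleftrightarrow> (\<exists>v\<in>D. v \<noteq> d) \<and> D \<noteq> {} \<and> (\<exists>v\<in>D. v \<noteq> a)"
        unfolding edges using True by (simp add: on_D ex_in_conv cong: bex_cong_simp)
      then show ?thesis using True by blast
    qed (simp add: edges)
  qed
  have "minimal_ve_dominating_set ?H {b}"
    by (rule minimal_ve_dominating_setI) (use neq in \<open>auto simp: dom\<close>)
  moreover have "minimal_ve_dominating_set ?H {a, d}"
    by (rule minimal_ve_dominating_setI) (use non(4) in \<open>auto simp: dom\<close>)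
  ultimately have "card {b} = card {a, d}" using well unfolding well_ve_dominated_def by blast
  then show False using non(4) by simp
qed

section \<open>Triangle-free graphs without induced paths on four vertices\<close>

lemma (in graph) no_triangle_if_triangle_free:
  assumes "triangle_free G" and adj: "u \<rightarrow> v" "v \<rightarrow> w" "u \<rightarrow> w"
  shows False
proof -
  let ?H = "G \<restriction> {u, v, w}"
  have sub: "{u, v, w} \<subseteq> verts G" using adj by (auto dest: adj_in_verts)
  then have ind: "induced_subgraph ?H G" by blast
  have irrefl: "\<not> x \<rightarrow> x" for x using adj_not_same by blast
  have neq: "u \<noteq> v" "v \<noteq> w" "u \<noteq> w" using adj irrefl by metis+
  have rev: "v \<rightarrow> u" "w \<rightarrow> v" "w \<rightarrow> u" using adj graph_symmetric by blast+
  have "graph ?H"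
    using digraphI_induced[OF ind] induced_graph_imp_symmetric[OF sym_arcs ind]
    by (rule digraph.graphI)
  moreover have "arcs_ends ?H = {(x, y). (x, y) \<in> verts ?H \<times> verts ?H \<and> x \<noteq> y}"
    by (auto simp: dominates_induce_subgraph_iff adj rev irrefl)
  ultimately have "complete_digraph 3 ?H" using neq by (simp add: complete_digraph_def)
  then show False using assms(1) induced_imp_subgraph[OF ind] unfolding triangle_free_def by blast
qed

text \<open>
  Fix an edge $uv$. The neighbourhoods of $v$ and $u$ are independent and disjoint, since there
  are no triangles. A neighbour $x$ of $v$ and a neighbour $y$ of $u$ are adjacent, since
  otherwise $x\,v\,u\,y$ is an induced path. They cover the graph by connectedness: if $w$ is
  adjacent to a neighbour $x$ of $v$, then $w$ is adjacent to $u$, since otherwise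
  $w\,x\,v\,u$ is an induced path.
\<close>

lemma (in graph) complete_bipartite_if_no_triangle_no_P4:
  assumes conn: "connected G" and card: "card (verts G) \<ge> 2"
    and no_triangle: "\<And>x y z. x \<rightarrow> y \<Longrightarrow> y \<rightarrow> z \<Longrightarrow> \<not> x \<rightarrow> z"
    and no_P4: "\<And>a b c d. a \<rightarrow> b \<Longrightarrow> b \<rightarrow> c \<Longrightarrow> c \<rightarrow> d \<Longrightarrow>
      \<not> a \<rightarrow> c \<Longrightarrow> \<not> b \<rightarrow> d \<Longrightarrow> a \<noteq> d \<Longrightarrow> a \<rightarrow> d"
  shows "complete_bipartite G"
proof -
  have sym: "y \<rightarrow> x" if "x \<rightarrow> y" for x y using that by (rule graph_symmetric)
  have reach: "x \<rightarrow>\<^sup>* y" if "x \<in> verts G" "y \<in> verts G" for x y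
    using symmetric_connected_imp_strongly_connected[OF sym_arcs conn] that
    by (auto simp: strongly_connected_def)
  obtain u v where uv: "u \<rightarrow> v"
  proof -
    obtain s where s: "s \<in> verts G" using conn by (auto simp: connected_conv)
    have "verts G \<noteq> {s}" using card by auto
    then obtain t where t: "t \<in> verts G" "t \<noteq> s" using s by blast
    from reach[OF s t(1)] have "s = t \<or> (\<exists>z. s \<rightarrow> z)"
      unfolding reachable_def by (cases rule: converse_rtrancl_on_cases) auto
    then show thesis using t(2) that by blast
  qed
  define U where "U = {x. v \<rightarrow> x}"
  define V where "V = {y. u \<rightarrow> y}"
  \<comment> \<open>Three edges in a row close up to a four-cycle, as they otherwise form a triangle or an
    induced path.\<close>
  have step: "q \<rightarrow> w" if "q \<rightarrow> p" "p \<rightarrow> x" "x \<rightarrow> w" for p q x w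
  proof (rule ccontr)
    assume not_adj: "\<not> q \<rightarrow> w"
    have "q \<noteq> w" using no_triangle[OF that(2,3)] that(1) sym by blast
    then show False
      using no_P4[OF that] no_triangle[OF that(1,2)] no_triangle[OF that(2,3)] not_adj by blast
  qed
  have disj: "U \<inter> V = {}" using no_triangle[OF uv] by (auto simp: U_def V_def)
  have mem: "u \<in> U" "v \<in> V" using uv sym by (auto simp: U_def V_def)
  have closed: "z \<in> U \<union> V" if "y \<in> U \<union> V" "y \<rightarrow> z" for y z
    using that step[OF uv, of y z] step[OF sym[OF uv], of y z] by (auto simp: U_def V_def)
  have "z \<in> U \<union> V" if "z \<in> verts G" for z
  proof -
    have "u \<in> verts G" using uv by (rule adj_in_verts)
    from reach[OF this that] have "(u, z) \<in> rtrancl_on (verts G) (arcs_ends G)"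
      by (simp add: reachable_def)
    then show ?thesis using mem closed by (induct rule: rtrancl_on_induct) auto
  qed
  then have verts: "verts G = U \<union> V" by (auto simp: U_def V_def dest: adj_in_verts)
  have adj: "arcs_ends G = U \<times> V \<union> V \<times> U"
  proof (intro equalityI subrelI)
    fix x y assume xy: "x \<rightarrow> y"
    then have "x \<in> U \<union> V" "y \<in> U \<union> V" using verts by (auto dest: adj_in_verts)
    moreover have "\<not> (x \<in> U \<and> y \<in> U)" "\<not> (x \<in> V \<and> y \<in> V)"
      using no_triangle[OF _ xy] by (auto simp: U_def V_def)
    ultimately show "(x, y) \<in> U \<times> V \<union> V \<times> U" by blast
  next
    have cross: "x \<rightarrow> y" if "x \<in> U" "y \<in> V" for x y
      using step[of x v u y] that uv sym by (auto simp: U_def V_def)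
    fix x y assume "(x, y) \<in> U \<times> V \<union> V \<times> U"
    then show "x \<rightarrow> y" using cross sym by blast
  qed
  have "finite U" "finite V" using verts finite_verts by (metis finite_Un)+
  then have "card U \<ge> 1" "card V \<ge> 1" using mem by (auto simp: Suc_le_eq card_gt_0_iff)
  moreover have "complete_bipartite_digraph (card U) (card V) G"
    unfolding complete_bipartite_digraph_def using graph_axioms verts disj adj
    by (intro conjI exI[of _ U] exI[of _ V]) (auto intro: graph.intro)
  ultimately show ?thesis unfolding complete_bipartite_def by blast
qed

theorem corollary13:
  fixes G :: "('a,'b) pre_digraph"
  assumes "graph G"
    and "connected G"
    and "card (verts G) \<ge> 2"
    and "triangle_free G"
  shows "perfectly_well_ve_dominated G \<longleftrightarrow> complete_bipartite G"
proof
  interpret graph G by (fact assms(1))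
  assume "perfectly_well_ve_dominated G"
  then show "complete_bipartite G"
    using complete_bipartite_if_no_triangle_no_P4[OF assms(2,3)]
      no_triangle_if_triangle_free[OF assms(4)] not_perfectly_well_ve_dominated_if_P4
    by blast
qed (rule perfectly_well_ve_dominated_if_complete_bipartite)

end
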